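(* Every cube tiling of $\mathbb{R}^{4}$ contains a column. That is, if $T\subseteq\mathbb{R}^4$ is such that the cubes $[0,1)^4+t$, $t\in T$, are pairwise disjoint (for distinct $t\in T$) and their union is $\mathbb{R}^4$, then there exist $s\in\mathbb{R}^4$ and $i\in\{1,\ldots,4\}$ such that $s+ke_i\in T$ for every $k\in\mathbb{Z}$, where $e_i$ is the $i$-th element of the standard basis of $\mathbb{R}^4$.
   Context: For $T\subseteq\mathbb{R}^n$, the family $[0,1)^n+T=\{[0,1)^n+t\colon t\in T\}$ is a cube tiling of $\mathbb{R}^n$ if for each pair of distinct $s,t\in T$ the cubes $[0,1)^n+s$ and $[0,1)^n+t$ are disjoint and $\bigcup_{t\in T}([0,1)^n+t)=\mathbb{R}^n$. No periodicity or lattice assumption is made on $T$. A column is a family of cubes of the form $\{[0,1)^n+(s+ke_i)\colon k\in\mathbb{Z}\}$, where $s\in\mathbb{R}^n$ and $e_i$ is an element of the standard basis of $\mathbb{R}^n$; a tiling contains a column if all the cubes of some column belong to the tiling. *)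

theory Defs
  imports "HOL-Analysis.Analysis"
begin

definition unit_cube :: "(real ^ 'n) set"
  where "unit_cube = {x. \<forall>i. x $ i \<in> {0..<1}}"

definition cube_at :: "real ^ 'n \<Rightarrow> (real ^ 'n) set"
  where "cube_at t = (\<lambda>x. x + t) ` unit_cube"

definition cube_family :: "(real ^ 'n) set \<Rightarrow> (real ^ 'n) set set"
  where "cube_family T = {cube_at t | t. t \<in> T}"

text \<open>Disjointness is required for distinct translation vectors; asking it of distinct
  members of the set \<open>cube_family T\<close> would be the same, as \<open>cube_at\<close> is injective.\<close>

definition cube_tiling :: "(real ^ 'n) set \<Rightarrow> bool"
  where "cube_tiling T \<longleftrightarrow>
    (\<forall>s\<in>T. \<forall>t\<in>T. s \<noteq> t \<longrightarrow> cube_at s \<inter> cube_at t = {}) \<and>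
    (\<Union>t\<in>T. cube_at t) = UNIV"

definition cube_column :: "real ^ 'n \<Rightarrow> 'n \<Rightarrow> (real ^ 'n) set set"
  where "cube_column s i = {cube_at (s + of_int k *\<^sub>R axis i 1) | k :: int. True}"

lemma mem_cube_at: "x \<in> cube_at t \<longleftrightarrow> (\<forall>i. t $ i \<le> x $ i \<and> x $ i < t $ i + 1)"
proof
  assume "x \<in> cube_at t"
  then show "\<forall>i. t $ i \<le> x $ i \<and> x $ i < t $ i + 1"
    by (auto simp: cube_at_def unit_cube_def)
next
  assume h: "\<forall>i. t $ i \<le> x $ i \<and> x $ i < t $ i + 1"
  have "x - t \<in> unit_cube"
    using h by (auto simp: unit_cube_def algebra_simps)
  then have "(x - t) + t \<in> cube_at t"
    unfolding cube_at_def by (rule imageI)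
  then show "x \<in> cube_at t" by simp
qed

lemma cube_at_inj: "cube_at s = cube_at t \<longleftrightarrow> s = t"
proof
  assume eq: "cube_at s = cube_at t"
  have "s \<in> cube_at s" "t \<in> cube_at t" by (auto simp: mem_cube_at)
  then have "s \<in> cube_at t" "t \<in> cube_at s" using eq by auto
  then show "s = t" by (auto simp: mem_cube_at vec_eq_iff intro: antisym)
qed simp

lemma cube_column_subset_iff:
  "cube_column s i \<subseteq> cube_family T \<longleftrightarrow> (\<forall>k :: int. s + of_int k *\<^sub>R axis i 1 \<in> T)"
  by (auto simp: cube_column_def cube_family_def cube_at_inj)

end

theory Submission
  imports Defs
begin

text \<open>
  Let \<open>t\<^sub>m\<close> be the cube position whose cube contains the integer point \<open>m\<close>, and let
  \<open>u m = m - t\<^sub>m\<close> be its offset, a vector of \<open>[0,1)\<^sup>4\<close>. By Keller's theorem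
  (\<open>keller_integer_difference\<close>) any two cube positions differ by a nonzero integer in some
  coordinate. For \<open>u\<close> this says that two distinct integer points always have a coordinate in which
  the points differ and the offsets agree (\<open>keller_code\<close>). If \<open>u\<close> is constant on an
  axis-parallel line of integer points, then the cubes along this line form a column. So the problem
  becomes purely combinatorial: a Keller code in dimension four is constant on some line
  (\<open>keller_code4_column\<close>).

  The combinatorial heart is a rigidity phenomenon in dimension three
  (\<open>has_new_column_if_codes_differ\<close>): if two three-dimensional Keller codes \<open>u\<close> and
  \<open>v\<close> are different, then \<open>u\<close> is constant on some line no point of which has
  the same value under \<open>u\<close> and \<open>v\<close>. In other words, a part of a three-dimensional
  tiling that contains no column cannot be tiled in a second way.

  Dimension four follows by exchanging layers. In a four-dimensional code the fourth offset does not
  depend on the fourth position, so for every value \<open>\<alpha>\<close> the set of all \<open>(x, y, z)\<close> with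
  fourth offset \<open>\<alpha>\<close> is the same in all layers. If two layers have different offsets somewhere,
  let \<open>\<alpha>\<close> be the fourth offset there. Replacing the one layer by the other on the set that
  belongs to \<open>\<alpha>\<close> yields a three-dimensional code again: a point in this set and a point
  outside of it have different fourth offsets, hence the four-dimensional condition, for any two
  layers, is met in one of the first three coordinates. Rigidity gives a line on which the original
  layer is constant and on which the two codes differ throughout. This line lies in the set of
  \<open>\<alpha>\<close>, so the fourth offset is constant on it as well. If on the other hand all layers agree,
  then every line in the fourth direction will do.
\<close>

section \<open>Rigidity of three-dimensional codes\<close>

text \<open>
  The triple stands for the code sending \<open>(x, y, z)\<close> to \<open>(F y z, G x z, H x y)\<close>. Leaving out
  the \<open>i\<close>-th position in the \<open>i\<close>-th component loses nothing: for two points that differ only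
  in their \<open>i\<close>-th position, the code condition can only be met in the \<open>i\<close>-th coordinate.
\<close>
definition offset_code3 ::
    "('b \<Rightarrow> 'c \<Rightarrow> 'k) \<Rightarrow> ('a \<Rightarrow> 'c \<Rightarrow> 'k) \<Rightarrow> ('a \<Rightarrow> 'b \<Rightarrow> 'k) \<Rightarrow> bool"
  where "offset_code3 F G H \<longleftrightarrow> (\<forall>x y z x' y' z'. (x, y, z) \<noteq> (x', y', z') \<longrightarrow>
    x \<noteq> x' \<and> F y z = F y' z' \<or> y \<noteq> y' \<and> G x z = G x' z' \<or> z \<noteq> z' \<and> H x y = H x' y')"

text \<open>
  A line in the first direction on which the code \<open>(F, G, H)\<close> is constant and nowhere equal to
  \<open>(F', G', H')\<close>. The component \<open>F y z\<close> is automatically constant on such a line. The other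
  directions are covered below by permuting the coordinates.
\<close>
definition new_column ::
    "('b \<Rightarrow> 'c \<Rightarrow> 'k) \<Rightarrow> ('a \<Rightarrow> 'c \<Rightarrow> 'k) \<Rightarrow> ('a \<Rightarrow> 'b \<Rightarrow> 'k) \<Rightarrow>
     ('b \<Rightarrow> 'c \<Rightarrow> 'k) \<Rightarrow> ('a \<Rightarrow> 'c \<Rightarrow> 'k) \<Rightarrow> ('a \<Rightarrow> 'b \<Rightarrow> 'k) \<Rightarrow> bool"
  where "new_column F G H F' G' H' \<longleftrightarrow> (\<exists>y z.
    (\<forall>x x'. G x z = G x' z) \<and> (\<forall>x x'. H x y = H x' y) \<and>
    (\<forall>x. F y z \<noteq> F' y z \<or> G x z \<noteq> G' x z \<or> H x y \<noteq> H' x y))"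

definition has_new_column ::
    "('b \<Rightarrow> 'c \<Rightarrow> 'k) \<Rightarrow> ('a \<Rightarrow> 'c \<Rightarrow> 'k) \<Rightarrow> ('a \<Rightarrow> 'b \<Rightarrow> 'k) \<Rightarrow>
     ('b \<Rightarrow> 'c \<Rightarrow> 'k) \<Rightarrow> ('a \<Rightarrow> 'c \<Rightarrow> 'k) \<Rightarrow> ('a \<Rightarrow> 'b \<Rightarrow> 'k) \<Rightarrow> bool"
  where "has_new_column F G H F' G' H' \<longleftrightarrow> new_column F G H F' G' H'
    \<or> new_column G F (\<lambda>y x. H x y) G' F' (\<lambda>y x. H' x y)
    \<or> new_column H (\<lambda>z y. F y z) (\<lambda>z x. G x z) H' (\<lambda>z y. F' y z) (\<lambda>z x. G' x z)"

lemma offset_code3_swap12: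
  "offset_code3 F G H \<Longrightarrow> offset_code3 G F (\<lambda>y x. H x y)"
  unfolding offset_code3_def by fast

lemma offset_code3_swap23:
  "offset_code3 F G H \<Longrightarrow> offset_code3 (\<lambda>z y. F y z) H G"
  unfolding offset_code3_def by fast

lemma offset_code3_pair:
  assumes "offset_code3 F G H"
  shows "F y z = F y' z' \<or> G x z = G x' z' \<or> H x y = H x' y'"
  using assms[unfolded offset_code3_def, THEN spec, THEN spec, THEN spec, THEN spec, THEN spec,
      THEN spec, of x y z x' y' z'] by blast

text \<open>
  Fixing \<open>x\<close> leaves a two-dimensional code, and a two-dimensional code has a constant component:
  if \<open>G x z\<close> and \<open>G x z'\<close> as well as \<open>H x y\<close> and \<open>H x y'\<close> were different, the
  points \<open>(x, y, z)\<close> and \<open>(x, y', z')\<close> would violate the code condition.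
\<close>
lemma offset_code3_slice1:
  assumes "offset_code3 F G H"
  shows "(\<forall>z z'. G x z = G x z') \<or> (\<forall>y y'. H x y = H x y')"
proof -
  have "G x z = G x z' \<or> H x y = H x y'" for y y' z z'
    using assms[unfolded offset_code3_def, THEN spec, THEN spec, THEN spec, THEN spec, THEN spec,
        THEN spec, of x y z x y' z'] by blast
  then show ?thesis by blast
qed

lemma offset_code3_slice2:
  assumes "offset_code3 F G H"
  shows "(\<forall>z z'. F y z = F y z') \<or> (\<forall>x x'. H x y = H x' y)"
  using offset_code3_slice1[OF offset_code3_swap12[OF assms]] by simp

lemma offset_code3_slice3:
  assumes "offset_code3 F G H"
  shows "(\<forall>y y'. F y z = F y' z) \<or> (\<forall>x x'. G x z = G x' z)"
  using offset_code3_slice2[OF offset_code3_swap23[OF assms]] by simp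

text \<open>
  The essential case of rigidity, up to symmetry. Assuming that there is no such line, each line on
  which \<open>(F, G, H)\<close> is constant contains a point where both codes agree (\<open>col1\<close>,
  \<open>col2\<close>, \<open>col3\<close>). The slice lemmas produce many constant lines, and the agreements
  that result either force \<open>H x\<close> to be constant in the case where it is supposed to vary for every
  \<open>x\<close>, or yield two points that violate the code condition of \<open>(F', G', H')\<close>.
\<close>
lemma has_new_column_if_first_differs_and_second_varies:
  assumes u: "offset_code3 F G H" and v: "offset_code3 F' G' H'"
    and diff: "F y0 z0 \<noteq> F' y0 z0" and nonconst: "\<not> (\<forall>x x'. G x z0 = G x' z0)"
  shows "has_new_column F G H F' G' H'"
proof (rule ccontr)
  assume none: "\<not> ?thesis"
  note ux = offset_code3_slice1[OF u] and uy = offset_code3_slice2[OF u]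
    and uz = offset_code3_slice3[OF u]
  note vx = offset_code3_slice1[OF v] and vy = offset_code3_slice2[OF v]
    and vz = offset_code3_slice3[OF v]
  have col1: "\<exists>x. F y z = F' y z \<and> G x z = G' x z \<and> H x y = H' x y"
    if "\<forall>x x'. G x z = G x' z" "\<forall>x x'. H x y = H x' y" for y z
    using none that unfolding has_new_column_def new_column_def by blast
  have col2: "\<exists>y. F y z = F' y z \<and> G x z = G' x z \<and> H x y = H' x y"
    if "\<forall>y y'. F y z = F y' z" "\<forall>y y'. H x y = H x y'" for x z
    using none that unfolding has_new_column_def new_column_def by blast
  have col3: "\<exists>z. F y z = F' y z \<and> G x z = G' x z \<and> H x y = H' x y"
    if "\<forall>z z'. F y z = F y z'" "\<forall>z z'. G x z = G x z'" for x y
    using none that unfolding has_new_column_def new_column_def by blast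
  define a where "a = F y0 z0"
  have Fz0: "F y z0 = a" for y
    using uz[of z0] nonconst a_def by metis
  show False
  proof (cases "\<forall>x. \<exists>y y'. H x y \<noteq> H x y'")
    case True
    \<comment> \<open>Here \<open>G\<close> depends on \<open>x\<close> only, and \<open>F\<close> on \<open>z\<close> only.\<close>
    have Gconst: "G x z = G x z'" for x z z' using ux True by metis
    have Fconst: "F y z = F y' z" for y y' z using uz nonconst Gconst by metis
    obtain x x' where xx': "G x z0 \<noteq> G x' z0" using nonconst by blast
    show False
    proof (cases "\<forall>z. F y0 z = a")
      case True
      \<comment> \<open>Now all lines in the third direction are constant, and each contains an agreement.\<close>
      then have Fa: "F y z = a" for y z using Fconst by metis
      have hit: "\<exists>z. F' y z = a \<and> G x z = G' x z \<and> H x y = H' x y" for x y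
        using col3[of y x] Fa Gconst by metis
      then have HH: "H' x y = H x y" for x y by metis
      have GG: "G' x z = G x z" for x z
        using hit vx[of x] HH Gconst \<open>\<forall>x. \<exists>y y'. H x y \<noteq> H x y'\<close> by metis
      have F'const: "F' y z = F' y' z" for y y' z
        using vz[of z] GG Gconst xx' by metis
      \<comment> \<open>As \<open>F'\<close> and \<open>G\<close> both vary, the code \<open>(F', G', H')\<close> forces
        \<open>H x y = H x' y'\<close> for all \<open>y\<close> and \<open>y'\<close>, so \<open>H x\<close> is constant.\<close>
      obtain z where z: "F' y0 z = a" using hit by blast
      have "F' y0 z0 \<noteq> a" using diff a_def by simp
      then have "F' y z \<noteq> F' y' z0" for y y' using z F'const by metis
      then have "H x y = H x' y'" for y y'
        using offset_code3_pair[OF v, of y z y' z0 x x'] xx' GG Gconst HH by metis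
      then show False using \<open>\<forall>x. \<exists>y y'. H x y \<noteq> H x y'\<close> by metis
    next
      case False
      then obtain z where z: "F y0 z \<noteq> a" by blast
      then have "F y z \<noteq> F y' z0" for y y' using Fconst Fz0 by metis
      then have "H x y = H x' y'" for y y'
        using offset_code3_pair[OF u, of y z y' z0 x x'] xx' Gconst by metis
      then show False using True by metis
    qed
  next
    case False
    \<comment> \<open>Each \<open>x\<close> with \<open>H x\<close> constant gives a constant line in the second direction.\<close>
    then obtain x1 c where x1: "H x1 y = c" for y by metis
    have hit1: "G x z0 = G' x z0 \<and> (\<exists>y. F' y z0 = a)" if "\<forall>y y'. H x y = H x y'" for x
      using col2[of z0 x] Fz0 that by metis
    obtain y3 where y3: "F' y3 z0 = a" using hit1[of x1] x1 by metis
    define d where "d = G' x1 z0"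
    have G'd: "G' x z0 = d" for x
      using vz[of z0] y3 diff unfolding a_def d_def by metis
    \<comment> \<open>As \<open>G\<close> varies at \<open>z0\<close> but \<open>G'\<close> does not, there is an \<open>x2\<close> where they
      differ; then \<open>H x2\<close> is not constant, and \<open>G x2\<close> is.\<close>
    obtain x2 where x2: "G x2 z0 \<noteq> d" using nonconst by metis
    define e where "e = G x2 z0"
    have Hx2: "\<exists>y y'. H x2 y \<noteq> H x2 y'" using hit1[of x2] G'd x2 by metis
    then have Ge: "G x2 z = e" for z using ux[of x2] e_def by metis
    \<comment> \<open>If \<open>H x2 y\<close> is not \<open>c\<close>, then \<open>H\<close> varies at \<open>y\<close>, so the line through
      \<open>(x2, y)\<close> in the third direction is constant and contains an agreement.\<close>
    have new: "H' x2 y = H x2 y \<and> F y z = a \<and> (\<exists>z. G' x2 z = e)" if "H x2 y \<noteq> c" for y z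
    proof -
      have "\<forall>z z'. F y z = F y z'" using uy[of y] that x1 by metis
      then show ?thesis using col3[of y x2] Ge Fz0 by metis
    qed
    \<comment> \<open>The values \<open>e\<close> (by \<open>new\<close>) and \<open>d\<close> (at \<open>z0\<close>) show that
      \<open>G' x2\<close> varies, so \<open>H' x2\<close> is a constant \<open>h\<close>, whereas \<open>H x2\<close> takes both values \<open>c\<close> and \<open>h\<close>.\<close>
    obtain y where y: "H x2 y \<noteq> c" using Hx2 by metis
    define h where "h = H x2 y"
    have H'h: "H' x2 y' = h" for y'
      using vx[of x2] new[OF y] G'd x2 unfolding e_def h_def by metis
    obtain y' where y': "H x2 y' = c" using Hx2 new H'h by metis
    \<comment> \<open>The line through \<open>(x2, y')\<close> in the third direction has no agreement, as
      \<open>H\<close> and \<open>H'\<close> differ there. So it is not constant, that is, \<open>F y'\<close> varies.\<close>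
    obtain z1 where z1: "F y' z1 \<noteq> a"
      using col3[of y' x2] Ge Fz0 y' H'h y h_def by metis
    have Hc: "H x y' = c" for x using uy[of y'] z1 Fz0 y' by metis
    have Gz1: "G x z1 = e" for x
      using uz[of z1] z1 new[OF y, of z1] Ge by metis
    \<comment> \<open>The line through \<open>(y', z1)\<close> in the first direction is constant.\<close>
    obtain x3 where x3: "F' y' z1 \<noteq> a" "G' x3 z1 = e" "H' x3 y' = c"
      using col1[of z1 y'] Gz1 Hc z1 by metis
    have "F' y' z0 \<noteq> a"
      using vy[of y'] x3 H'h[of y'] y h_def by metis
    then have "y3 \<noteq> y'" using y3 by auto
    moreover have "h \<noteq> c" using y h_def by simp
    moreover have "e \<noteq> d" using x2 e_def by simp
    \<comment> \<open>At \<open>(x2, y3, z0)\<close> the second code is \<open>(a, d, h)\<close>; at \<open>(x3, y', z1)\<close>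
      it differs from this in all three components.\<close>
    ultimately show False
      using offset_code3_pair[OF v, of y3 z0 y' z1 x2 x3] y3 G'd[of x2] H'h[of y3] x3 by metis
  qed
qed

lemma has_new_column_swap12:
  assumes "has_new_column G F (\<lambda>y x. H x y) G' F' (\<lambda>y x. H' x y)"
  shows "has_new_column F G H F' G' H'"
  using assms unfolding has_new_column_def new_column_def
  by (elim disjE exE conjE) blast+

lemma has_new_column_swap23:
  assumes "has_new_column (\<lambda>z y. F y z) H G (\<lambda>z y. F' y z) H' G'"
  shows "has_new_column F G H F' G' H'"
  using assms unfolding has_new_column_def new_column_def
  by (elim disjE exE conjE) blast+

text \<open>
  The two codes differ on the whole line through \<open>(y0, z0)\<close> in the first direction, since
  \<open>F\<close> does not depend on \<open>x\<close>. Either this line already is the one that is wanted, or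
  \<open>G\<close> or \<open>H\<close> varies along it, and these two cases are symmetric.
\<close>
lemma has_new_column_if_first_differs:
  assumes u: "offset_code3 F G H" and v: "offset_code3 F' G' H'"
    and diff: "F y0 z0 \<noteq> F' y0 z0"
  shows "has_new_column F G H F' G' H'"
proof (cases "(\<forall>x x'. G x z0 = G x' z0) \<and> (\<forall>x x'. H x y0 = H x' y0)")
  case True
  then have "new_column F G H F' G' H'"
    using diff unfolding new_column_def by blast
  then show ?thesis by (simp add: has_new_column_def)
next
  case False
  then consider "\<not> (\<forall>x x'. G x z0 = G x' z0)" | "\<not> (\<forall>x x'. H x y0 = H x' y0)" by blast
  then show ?thesis
  proof cases
    case 1
    then show ?thesis
      using has_new_column_if_first_differs_and_second_varies[OF u v diff] by simp
  next
    case 2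
    have "has_new_column (\<lambda>z y. F y z) H G (\<lambda>z y. F' y z) H' G'"
      using has_new_column_if_first_differs_and_second_varies[OF
          offset_code3_swap23[OF u] offset_code3_swap23[OF v] diff 2] .
    then show ?thesis by (rule has_new_column_swap23)
  qed
qed

theorem has_new_column_if_codes_differ:
  assumes u: "offset_code3 F G H" and v: "offset_code3 F' G' H'"
    and diff: "F y z \<noteq> F' y z \<or> G x z \<noteq> G' x z \<or> H x y \<noteq> H' x y"
  shows "has_new_column F G H F' G' H'"
  using diff
proof (elim disjE)
  assume "F y z \<noteq> F' y z"
  then show ?thesis by (rule has_new_column_if_first_differs[OF u v])
next
  assume "G x z \<noteq> G' x z"
  then show ?thesis
    by (rule has_new_column_swap12[OF has_new_column_if_first_differs[OF
          offset_code3_swap12[OF u] offset_code3_swap12[OF v]]])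
next
  assume "H x y \<noteq> H' x y"
  then show ?thesis
    by (rule has_new_column_swap23[OF has_new_column_swap12[OF has_new_column_if_first_differs[OF
          offset_code3_swap12[OF offset_code3_swap23[OF u]]
          offset_code3_swap12[OF offset_code3_swap23[OF v]]]]])
qed

section \<open>Constant lines of four-dimensional codes\<close>

definition keller_code :: "('a ^ 'n \<Rightarrow> 'k ^ 'n) \<Rightarrow> bool"
  where "keller_code u \<longleftrightarrow> (\<forall>m m'. m \<noteq> m' \<longrightarrow> (\<exists>i. m $ i \<noteq> m' $ i \<and> u m $ i = u m' $ i))"

text \<open>
  Layers are compared by rigidity. If two layers \<open>d\<close> and \<open>d'\<close> have different offsets, then
  layer \<open>d\<close> is compared with the code \<open>(g1, g2, g3)\<close>, which results from it by inserting
  layer \<open>d'\<close> at those points where the fourth offset has a fixed value \<open>\<alpha>\<close>.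
\<close>
theorem keller_code4_column:
  fixes u :: "'a ^ 4 \<Rightarrow> 'k ^ 4"
  assumes code: "keller_code u"
  shows "\<exists>m i. \<forall>m'. (\<forall>j. j \<noteq> i \<longrightarrow> m' $ j = m $ j) \<longrightarrow> u m' = u m"
proof -
  define p :: "'a \<Rightarrow> 'a \<Rightarrow> 'a \<Rightarrow> 'a \<Rightarrow> 'a ^ 4" where
    "p a b c d = (\<chi> i. if i = 1 then a else if i = 2 then b else if i = 3 then c else d)"
    for a b c d
  have p [simp]: "p a b c d $ 1 = a" "p a b c d $ 2 = b" "p a b c d $ 3 = c" "p a b c d $ 4 = d"
    for a b c d by (simp_all add: p_def)
  have p_eta: "p (m $ 1) (m $ 2) (m $ 3) (m $ 4) = m" for m
    by (simp add: vec_eq_iff forall_4)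
  have keller: "a \<noteq> a' \<and> u (p a b c d) $ 1 = u (p a' b' c' d') $ 1 \<or>
      b \<noteq> b' \<and> u (p a b c d) $ 2 = u (p a' b' c' d') $ 2 \<or>
      c \<noteq> c' \<and> u (p a b c d) $ 3 = u (p a' b' c' d') $ 3 \<or>
      d \<noteq> d' \<and> u (p a b c d) $ 4 = u (p a' b' c' d') $ 4"
    if "(a, b, c, d) \<noteq> (a', b', c', d')" for a b c d a' b' c' d'
  proof -
    have "p a b c d \<noteq> p a' b' c' d'" using that by (auto simp: vec_eq_iff forall_4)
    then obtain i where "p a b c d $ i \<noteq> p a' b' c' d' $ i"
      "u (p a b c d) $ i = u (p a' b' c' d') $ i"
      using code unfolding keller_code_def by blast
    then show ?thesis using exhaust_4[of i] by auto
  qed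
  define f1 where "f1 b c d = u (p undefined b c d) $ 1" for b c d
  define f2 where "f2 a c d = u (p a undefined c d) $ 2" for a c d
  define f3 where "f3 a b d = u (p a b undefined d) $ 3" for a b d
  define f4 where "f4 a b c = u (p a b c undefined) $ 4" for a b c
  have u1: "u (p a b c d) $ 1 = f1 b c d" for a b c d
    unfolding f1_def using keller[of a b c d undefined b c d] by (cases "a = undefined") auto
  have u2: "u (p a b c d) $ 2 = f2 a c d" for a b c d
    unfolding f2_def using keller[of a b c d a undefined c d] by (cases "b = undefined") auto
  have u3: "u (p a b c d) $ 3 = f3 a b d" for a b c d
    unfolding f3_def using keller[of a b c d a b undefined d] by (cases "c = undefined") auto
  have u4: "u (p a b c d) $ 4 = f4 a b c" for a b c d
    unfolding f4_def using keller[of a b c d a b c undefined] by (cases "d = undefined") auto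
  note keller = keller[unfolded u1 u2 u3 u4]
  have u_eqI: "u (p a b c d) = u (p a' b' c' d')"
    if "f1 b c d = f1 b' c' d'" "f2 a c d = f2 a' c' d'" "f3 a b d = f3 a' b' d'"
      "f4 a b c = f4 a' b' c'" for a b c d a' b' c' d'
    using that by (simp add: vec_eq_iff forall_4 u1 u2 u3 u4)
  show ?thesis
  proof (cases "\<forall>a b c d d'. f1 b c d = f1 b c d' \<and> f2 a c d = f2 a c d' \<and> f3 a b d = f3 a b d'")
    case True
    have "u m' = u m" if "\<forall>j. j \<noteq> 4 \<longrightarrow> m' $ j = m $ j" for m m'
    proof -
      have "m' $ 1 = m $ 1" "m' $ 2 = m $ 2" "m' $ 3 = m $ 3" using that by simp_all
      then show ?thesis
        using u_eqI[of "m $ 2" "m $ 3" "m' $ 4" "m $ 2" "m $ 3" "m $ 4" "m $ 1" "m $ 1"]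
          p_eta[of m] p_eta[of m'] True by metis
    qed
    then show ?thesis by blast
  next
    case False
    then obtain a b c d d' where
      differ: "f1 b c d \<noteq> f1 b c d' \<or> f2 a c d \<noteq> f2 a c d' \<or> f3 a b d \<noteq> f3 a b d'" by blast
    define \<alpha> where "\<alpha> = f4 a b c"
    \<comment> \<open>The insertion must not depend on the position left out in each component. It does not:
      if only one of two points on a line has fourth offset \<open>\<alpha>\<close>, then the code condition
      between the layers forces both layers to agree in that component.\<close>
    define g1 where "g1 y z = (if \<exists>x. f4 x y z = \<alpha> then f1 y z d' else f1 y z d)" for y z
    define g2 where "g2 x z = (if \<exists>y. f4 x y z = \<alpha> then f2 x z d' else f2 x z d)" for x z
    define g3 where "g3 x y = (if \<exists>z. f4 x y z = \<alpha> then f3 x y d' else f3 x y d)" for x y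
    have g1: "g1 y z = (if f4 x y z = \<alpha> then f1 y z d' else f1 y z d)" for x y z
    proof (cases "\<exists>x'. f4 x' y z = \<alpha> \<and> f4 x y z \<noteq> \<alpha>")
      case True
      then obtain x' where x': "f4 x' y z = \<alpha>" "f4 x y z \<noteq> \<alpha>" by blast
      then have "x \<noteq> x'" by auto
      then have "f1 y z d' = f1 y z d" using keller[of x' y z d' x y z d] x' by auto
      then show ?thesis by (simp add: g1_def)
    qed (auto simp: g1_def)
    have g2: "g2 x z = (if f4 x y z = \<alpha> then f2 x z d' else f2 x z d)" for x y z
    proof (cases "\<exists>y'. f4 x y' z = \<alpha> \<and> f4 x y z \<noteq> \<alpha>")
      case True
      then obtain y' where y': "f4 x y' z = \<alpha>" "f4 x y z \<noteq> \<alpha>" by blast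
      then have "y \<noteq> y'" by auto
      then have "f2 x z d' = f2 x z d" using keller[of x y' z d' x y z d] y' by auto
      then show ?thesis by (simp add: g2_def)
    qed (auto simp: g2_def)
    have g3: "g3 x y = (if f4 x y z = \<alpha> then f3 x y d' else f3 x y d)" for x y z
    proof (cases "\<exists>z'. f4 x y z' = \<alpha> \<and> f4 x y z \<noteq> \<alpha>")
      case True
      then obtain z' where z': "f4 x y z' = \<alpha>" "f4 x y z \<noteq> \<alpha>" by blast
      then have "z \<noteq> z'" by auto
      then have "f3 x y d' = f3 x y d" using keller[of x y z' d' x y z d] z' by auto
      then show ?thesis by (simp add: g3_def)
    qed (auto simp: g3_def)
    have layer: "offset_code3 (\<lambda>y z. f1 y z d) (\<lambda>x z. f2 x z d) (\<lambda>x y. f3 x y d)"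
      unfolding offset_code3_def
    proof (intro allI impI)
      fix x y z x' y' z' :: 'a
      assume "(x, y, z) \<noteq> (x', y', z')"
      then show "x \<noteq> x' \<and> f1 y z d = f1 y' z' d \<or> y \<noteq> y' \<and> f2 x z d = f2 x' z' d
          \<or> z \<noteq> z' \<and> f3 x y d = f3 x' y' d"
        using keller[of x y z d x' y' z' d] by blast
    qed
    have recoloured: "offset_code3 g1 g2 g3"
      unfolding offset_code3_def
    proof (intro allI impI)
      fix x y z x' y' z' :: 'a
      assume "(x, y, z) \<noteq> (x', y', z')"
      then show "x \<noteq> x' \<and> g1 y z = g1 y' z' \<or> y \<noteq> y' \<and> g2 x z = g2 x' z'
          \<or> z \<noteq> z' \<and> g3 x y = g3 x' y'"
        unfolding g1[of y z x] g1[of y' z' x'] g2[of x z y] g2[of x' z' y']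
          g3[of x y z] g3[of x' y' z']
        using keller[of x y z d x' y' z' d] keller[of x y z d' x' y' z' d']
          keller[of x y z d' x' y' z' d] keller[of x y z d x' y' z' d'] by auto
    qed
    have f4_eq: "f4 x y z = \<alpha>"
      if "f1 y z d \<noteq> g1 y z \<or> f2 x z d \<noteq> g2 x z \<or> f3 x y d \<noteq> g3 x y" for x y z
      using that g1[of y z x] g2[of x z y] g3[of x y z] by (auto split: if_splits)
    have "f1 b c d \<noteq> g1 b c \<or> f2 a c d \<noteq> g2 a c \<or> f3 a b d \<noteq> g3 a b"
      using differ g1[of b c a] g2[of a c b] g3[of a b c] \<alpha>_def by simp
    then have "has_new_column (\<lambda>y z. f1 y z d) (\<lambda>x z. f2 x z d) (\<lambda>x y. f3 x y d) g1 g2 g3"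
      by (rule has_new_column_if_codes_differ[OF layer recoloured])
    then consider
        (dir1) y z where "\<And>x x'. f2 x z d = f2 x' z d" "\<And>x x'. f3 x y d = f3 x' y d"
          "\<And>x. f4 x y z = \<alpha>"
      | (dir2) x z where "\<And>y y'. f1 y z d = f1 y' z d" "\<And>y y'. f3 x y d = f3 x y' d"
          "\<And>y. f4 x y z = \<alpha>"
      | (dir3) x y where "\<And>z z'. f1 y z d = f1 y z' d" "\<And>z z'. f2 x z d = f2 x z' d"
          "\<And>z. f4 x y z = \<alpha>"
      unfolding has_new_column_def new_column_def using f4_eq by (elim disjE exE conjE) metis+
    then show ?thesis
    proof cases
      case dir1
      have "u m' = u (p a y z d)" if "\<forall>j. j \<noteq> 1 \<longrightarrow> m' $ j = p a y z d $ j" for m'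
      proof -
        have "m' = p (m' $ 1) y z d" using that p_eta[of m'] by simp
        moreover have "u (p (m' $ 1) y z d) = u (p a y z d)"
          by (rule u_eqI) (simp_all add: dir1(3), (rule dir1)+)
        ultimately show ?thesis by simp
      qed
      then show ?thesis by blast
    next
      case dir2
      have "u m' = u (p x a z d)" if "\<forall>j. j \<noteq> 2 \<longrightarrow> m' $ j = p x a z d $ j" for m'
      proof -
        have "m' = p x (m' $ 2) z d" using that p_eta[of m'] by simp
        moreover have "u (p x (m' $ 2) z d) = u (p x a z d)"
          by (rule u_eqI) (simp_all add: dir2(3), (rule dir2)+)
        ultimately show ?thesis by simp
      qed
      then show ?thesis by blast
    next
      case dir3
      have "u m' = u (p x y a d)" if "\<forall>j. j \<noteq> 3 \<longrightarrow> m' $ j = p x y a d $ j" for m'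
      proof -
        have "m' = p x y (m' $ 3) d" using that p_eta[of m'] by simp
        moreover have "u (p x y (m' $ 3) d) = u (p x y a d)"
          by (rule u_eqI) (simp_all add: dir3(3), (rule dir3)+)
        ultimately show ?thesis by simp
      qed
      then show ?thesis by blast
    qed
  qed
qed

section \<open>Integer differences of cube positions\<close>

lemma cube_tiling_iff_ex1: "cube_tiling T \<longleftrightarrow> (\<forall>x. \<exists>!t. t \<in> T \<and> x \<in> cube_at t)"
proof
  assume T: "cube_tiling T"
  show "\<forall>x. \<exists>!t. t \<in> T \<and> x \<in> cube_at t"
  proof
    fix x
    have "x \<in> (\<Union>t\<in>T. cube_at t)" using T by (simp add: cube_tiling_def)
    then show "\<exists>!t. t \<in> T \<and> x \<in> cube_at t"
      using T unfolding cube_tiling_def by blast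
  qed
next
  assume "\<forall>x. \<exists>!t. t \<in> T \<and> x \<in> cube_at t"
  then show "cube_tiling T" unfolding cube_tiling_def by blast
qed

lemma cube_tiling_unique:
  "\<lbrakk>cube_tiling T; s \<in> T; t \<in> T; x \<in> cube_at s; x \<in> cube_at t\<rbrakk> \<Longrightarrow> s = t"
  unfolding cube_tiling_iff_ex1 by blast

lemma cube_tiling_covers:
  assumes "cube_tiling T"
  obtains t where "t \<in> T" "x \<in> cube_at t"
  using assms unfolding cube_tiling_iff_ex1 by blast

text \<open>
  The cubes that meet a line in the \<open>i\<close>-th direction cut it into half-open unit intervals that
  follow each other without gaps; so their \<open>i\<close>-th coordinates are congruent modulo 1. In the
  proof, \<open>r\<close> runs through the successive cubes that are met on the way from \<open>x\<close> to \<open>y\<close>.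
\<close>
lemma line_coordinates_diff_int_le:
  fixes T :: "(real ^ 'n) set"
  assumes T: "cube_tiling T" and s: "s \<in> T" "x \<in> cube_at s" and t: "t \<in> T" "y \<in> cube_at t"
    and line: "\<And>j. j \<noteq> i \<Longrightarrow> x $ j = y $ j" and le: "x $ i \<le> y $ i"
  shows "t $ i - s $ i \<in> \<int>"
proof -
  have chain: "\<exists>r\<in>T. r $ i = s $ i + real k \<and> (\<forall>j. j \<noteq> i \<longrightarrow> r $ j \<le> x $ j \<and> x $ j < r $ j + 1)"
    for k
  proof (induction k)
    case 0
    then show ?case using s by (intro bexI[of _ s]) (auto simp: mem_cube_at)
  next
    case (Suc k)
    then obtain r where r: "r \<in> T" "r $ i = s $ i + real k"
      "\<And>j. j \<noteq> i \<Longrightarrow> r $ j \<le> x $ j \<and> x $ j < r $ j + 1" by blast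
    \<comment> \<open>The point of the line just behind the cube at \<open>r\<close> is \<open>q (r $ i + 1)\<close>.\<close>
    define q where "q c = (\<chi> j. if j = i then c else x $ j)" for c
    obtain r' where r': "r' \<in> T" "q (r $ i + 1) \<in> cube_at r'"
      using cube_tiling_covers[OF T] by blast
    have r'i: "r' $ i \<le> r $ i + 1" "r $ i < r' $ i"
      and r'j: "\<And>j. j \<noteq> i \<Longrightarrow> r' $ j \<le> x $ j \<and> x $ j < r' $ j + 1"
      using r'(2) by (auto simp: mem_cube_at q_def dest: spec[of _ i] split: if_splits)
    have "r' $ i = r $ i + 1"
    proof (rule ccontr)
      assume "r' $ i \<noteq> r $ i + 1"
      then have "q (r' $ i) \<in> cube_at r" "q (r' $ i) \<in> cube_at r'"
        using r'i r'j r(3) by (auto simp: mem_cube_at q_def)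
      then have "r = r'" using cube_tiling_unique[OF T r(1) r'(1)] by blast
      then show False using r'i by simp
    qed
    then show ?case using r' r'j r(2) by (intro bexI[of _ r']) auto
  qed
  define k where "k = nat \<lfloor>y $ i - s $ i\<rfloor>"
  have "s $ i \<le> y $ i" using s(2) le by (auto simp: mem_cube_at intro: order_trans)
  then have k: "real k \<le> y $ i - s $ i" "y $ i - s $ i < real k + 1"
    unfolding k_def by linarith+
  obtain r where r: "r \<in> T" "r $ i = s $ i + real k"
    "\<And>j. j \<noteq> i \<Longrightarrow> r $ j \<le> x $ j \<and> x $ j < r $ j + 1" using chain by blast
  have "r $ j \<le> y $ j \<and> y $ j < r $ j + 1" for j
    using r(2) r(3)[of j] k line[of j] by (cases "j = i") auto
  then have "y \<in> cube_at r" by (simp add: mem_cube_at)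
  then have "r = t" using cube_tiling_unique[OF T r(1) t(1) _ t(2)] by blast
  then show ?thesis using r(2) by auto
qed

lemma line_coordinates_diff_int:
  fixes T :: "(real ^ 'n) set"
  assumes T: "cube_tiling T" and s: "s \<in> T" "x \<in> cube_at s" and t: "t \<in> T" "y \<in> cube_at t"
    and line: "\<And>j. j \<noteq> i \<Longrightarrow> x $ j = y $ j"
  shows "t $ i - s $ i \<in> \<int>"
proof (cases "x $ i \<le> y $ i")
  case True
  show ?thesis by (rule line_coordinates_diff_int_le[OF T s t line True])
next
  case False
  then have "s $ i - t $ i \<in> \<int>"
    using line_coordinates_diff_int_le[OF T t s, of i] line by force
  then show ?thesis using Ints_minus by fastforce
qed

text \<open>
  Keller's shift: all positions whose \<open>i\<close>-th coordinate is congruent to \<open>c\<close> modulo 1 are moved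
  by \<open>\<delta>\<close> in the \<open>i\<close>-th direction.
\<close>
definition shift_class :: "'n \<Rightarrow> real \<Rightarrow> real \<Rightarrow> real ^ 'n \<Rightarrow> real ^ 'n"
  where "shift_class i c \<delta> t = (if t $ i - c \<in> \<int> then t + \<delta> *\<^sub>R axis i 1 else t)"

lemma mem_cube_at_shift:
  "x \<in> cube_at (t + v) \<longleftrightarrow> x - v \<in> cube_at t"
  by (simp add: mem_cube_at algebra_simps)

text \<open>
  A line in the \<open>i\<close>-th direction meets only cubes of one residue class, so the cubes on it are
  either all shifted together or all left in place, and the line stays tiled.
\<close>
lemma cube_tiling_shift_class:
  fixes T :: "(real ^ 'n) set"
  assumes T: "cube_tiling T"
  shows "cube_tiling (shift_class i c \<delta> ` T)"
  unfolding cube_tiling_iff_ex1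
proof
  fix x :: "real ^ 'n"
  define v :: "real ^ 'n" where "v = \<delta> *\<^sub>R axis i 1"
  have v: "v $ j = 0" if "j \<noteq> i" for j using that by (simp add: v_def axis_def)
  obtain s where s: "s \<in> T" "x \<in> cube_at s" using cube_tiling_covers[OF T] by blast
  obtain t where t: "t \<in> T" "x - v \<in> cube_at t" using cube_tiling_covers[OF T] by blast
  have st: "t $ i - s $ i \<in> \<int>"
    by (rule line_coordinates_diff_int[OF T s t]) (simp add: v)
  have same: "s $ i - c \<in> \<int> \<longleftrightarrow> t $ i - c \<in> \<int>"
  proof
    assume "s $ i - c \<in> \<int>"
    from Ints_add[OF this st] show "t $ i - c \<in> \<int>" by simp
  next
    assume "t $ i - c \<in> \<int>"
    from Ints_diff[OF this st] show "s $ i - c \<in> \<int>" by simp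
  qed
  show "\<exists>!r. r \<in> shift_class i c \<delta> ` T \<and> x \<in> cube_at r"
  proof (rule ex1I[of _ "if s $ i - c \<in> \<int> then t + v else s"])
    show "(if s $ i - c \<in> \<int> then t + v else s) \<in> shift_class i c \<delta> ` T \<and>
        x \<in> cube_at (if s $ i - c \<in> \<int> then t + v else s)"
      using s t same by (auto simp: mem_cube_at_shift shift_class_def v_def intro!: image_eqI)
  next
    fix r assume "r \<in> shift_class i c \<delta> ` T \<and> x \<in> cube_at r"
    then obtain r0 where r0: "r0 \<in> T" "r = shift_class i c \<delta> r0" "x \<in> cube_at r" by blast
    show "r = (if s $ i - c \<in> \<int> then t + v else s)"
    proof (cases "r0 $ i - c \<in> \<int>")
      case True
      then have "r = r0 + v" using r0 by (simp add: shift_class_def v_def)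
      then have "r0 = t"
        using cube_tiling_unique[OF T r0(1) t(1) _ t(2)] r0(3) by (simp add: mem_cube_at_shift)
      then show ?thesis using True same \<open>r = r0 + v\<close> by simp
    next
      case False
      then have "r = r0" using r0 by (simp add: shift_class_def)
      then have "r0 = s" using cube_tiling_unique[OF T r0(1) s(1) _ s(2)] r0(3) by simp
      then show ?thesis using False \<open>r = r0\<close> by simp
    qed
  qed
qed

text \<open>
  If \<open>s\<close> and \<open>t\<close> had no coordinate with a nonzero integer difference, then shifting the class
  of \<open>t\<close> in a coordinate \<open>i\<close> where they differ would make this coordinate equal and leave
  \<open>s\<close> in place. So induction on the number of different coordinates applies, unless
  \<open>t\<close> lands on \<open>s\<close>. In that case the cubes at \<open>s\<close> and \<open>t\<close> meet a common line in direction
  \<open>i\<close>, and their difference is an integer after all.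
\<close>
theorem keller_integer_difference:
  fixes T :: "(real ^ 'n) set"
  assumes "cube_tiling T" "s \<in> T" "t \<in> T" "s \<noteq> t"
  shows "\<exists>i. s $ i \<noteq> t $ i \<and> t $ i - s $ i \<in> \<int>"
  using assms
proof (induction "card {i. s $ i \<noteq> t $ i}" arbitrary: T t rule: less_induct)
  case less
  note T = less.prems(1)
  show ?case
  proof (rule ccontr)
    assume none: "\<not> ?thesis"
    obtain i where i: "s $ i \<noteq> t $ i" using less.prems(4) by (auto simp: vec_eq_iff)
    define f where "f = shift_class i (t $ i) (s $ i - t $ i)"
    define t' where "t' = f t"
    have t': "t' $ j = (if j = i then s $ i else t $ j)" for j
      by (simp add: t'_def f_def shift_class_def axis_def)
    have "s $ i - t $ i \<notin> \<int>" using none i Ints_minus[of "s $ i - t $ i"] by auto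
    then have fs: "f s = s" by (simp add: f_def shift_class_def)
    show False
    proof (cases "t' = s")
      case True
      have "t $ i - s $ i \<in> \<int>"
        by (rule line_coordinates_diff_int[OF T less.prems(2) _ less.prems(3), of s t])
          (use True t' in \<open>auto simp: mem_cube_at split: if_splits\<close>)
      then show False using none i by blast
    next
      case False
      have "{j. s $ j \<noteq> t' $ j} \<subset> {j. s $ j \<noteq> t $ j}" using i t' by auto
      then have "card {j. s $ j \<noteq> t' $ j} < card {j. s $ j \<noteq> t $ j}"
        by (intro psubset_card_mono) auto
      moreover have "cube_tiling (f ` T)"
        unfolding f_def by (rule cube_tiling_shift_class[OF T])
      moreover have "s \<in> f ` T" "t' \<in> f ` T"
        using less.prems(2,3) fs t'_def by (auto intro: image_eqI[of _ f s])
      ultimately have "\<exists>j. s $ j \<noteq> t' $ j \<and> t' $ j - s $ j \<in> \<int>"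
        using less.hyps False[symmetric] by blast
      then show False using none t' by (auto split: if_splits)
    qed
  qed
qed

section \<open>Columns in cube tilings\<close>

text \<open>
  The offset of \<open>m\<close> is measured from the cube that contains the integer point \<open>m\<close>. Two offsets
  lie in \<open>[0,1)\<close> in each coordinate, so an integer difference of cube positions means that
  the offsets agree and that the integer points differ by the same amount.
\<close>
theorem cube_tiling_keller_code:
  fixes T :: "(real ^ 'n) set"
  assumes T: "cube_tiling T"
  obtains u :: "int ^ 'n \<Rightarrow> real ^ 'n"
  where "keller_code u" and "\<And>m. (\<chi> i. of_int (m $ i)) - u m \<in> T"
proof -
  define z :: "int ^ 'n \<Rightarrow> real ^ 'n" where "z m = (\<chi> i. of_int (m $ i))" for m
  have z [simp]: "z m $ i = of_int (m $ i)" for m i by (simp add: z_def)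
  have "\<exists>t. t \<in> T \<and> z m \<in> cube_at t" for m using cube_tiling_covers[OF T] by blast
  then obtain t where t: "\<And>m. t m \<in> T" "\<And>m. z m \<in> cube_at (t m)" by metis
  have tz: "t m $ i \<le> of_int (m $ i) \<and> of_int (m $ i) < t m $ i + 1" for m i
    using t(2)[of m] by (simp add: mem_cube_at)
  have "keller_code (\<lambda>m. z m - t m)"
    unfolding keller_code_def
  proof (intro allI impI)
    fix m m' :: "int ^ 'n" assume "m \<noteq> m'"
    then obtain j where j: "m $ j \<noteq> m' $ j" by (auto simp: vec_eq_iff)
    have "t m \<noteq> t m'"
    proof
      assume "t m = t m'"
      then have "of_int (m $ j) < (of_int (m' $ j) + 1 :: real)"
        "of_int (m' $ j) < (of_int (m $ j) + 1 :: real)"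
        using tz[of m j] tz[of m' j] by simp_all
      then show False using j by linarith
    qed
    then obtain i where i: "t m $ i \<noteq> t m' $ i" "t m' $ i - t m $ i \<in> \<int>"
      using keller_integer_difference[OF T t(1) t(1)] by blast
    then obtain k where k: "t m' $ i - t m $ i = of_int k" by (auto elim: Ints_cases)
    have "m' $ i - m $ i = k" using k tz[of m i] tz[of m' i] by linarith
    then have "m $ i \<noteq> m' $ i" "(z m - t m) $ i = (z m' - t m') $ i" using k i by auto
    then show "\<exists>i. m $ i \<noteq> m' $ i \<and> (z m - t m) $ i = (z m' - t m') $ i" by blast
  qed
  moreover have "(\<chi> i. of_int (m $ i)) - (z m - t m) \<in> T" for m
    using t(1)[of m] by (simp add: z_def)
  ultimately show thesis by (rule that)
qed

text \<open>
  Along a line on which the offset is constant, the cube positions advance by unit steps together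
  with the integer points.
\<close>
theorem theorem6:
  fixes T :: "(real ^ 4) set"
  assumes "cube_tiling T"
  shows "\<exists>s i. cube_column s i \<subseteq> cube_family T"
proof -
  obtain u :: "int ^ 4 \<Rightarrow> real ^ 4"
    where u: "keller_code u" and cube: "\<And>m. (\<chi> j. of_int (m $ j)) - u m \<in> T"
    using cube_tiling_keller_code[OF assms] by blast
  obtain m i where line: "\<And>m'. (\<forall>j. j \<noteq> i \<longrightarrow> m' $ j = m $ j) \<Longrightarrow> u m' = u m"
    using keller_code4_column[OF u] by blast
  define s where "s = (\<chi> j. of_int (m $ j)) - u m"
  have "s + of_int k *\<^sub>R axis i 1 \<in> T" for k :: int
  proof -
    define m' where "m' = (\<chi> j. if j = i then m $ i + k else m $ j)"
    have "u m' = u m" by (rule line) (simp add: m'_def)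
    then have "(\<chi> j. of_int (m' $ j)) - u m' = s + of_int k *\<^sub>R axis i 1"
      by (simp add: s_def m'_def vec_eq_iff axis_def)
    then show ?thesis using cube[of m'] by simp
  qed
  then show ?thesis unfolding cube_column_subset_iff by blast
qed

end
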